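(* Let $G$ be a graph, $Q\subseteq V(G)$ and $r:Q\to\{2,3\}$, and suppose $G$ is a minimal $(Q,r)$-vertex-connected graph. Then every cycle of $G$ contains a vertex of $Q$.
   Context: Two vertices are $k$-vertex-connected if there are $k$ internally vertex-disjoint paths between them. $G$ is $(Q,r)$-vertex-connected if every pair $x,y\in Q$ is $\min\{r(x),r(y)\}$-vertex-connected in $G$; it is minimal if deleting any edge or vertex of $G$ violates this requirement. *)

theory Defs
  imports Main
begin

definition graph :: "'a set \<Rightarrow> 'a set set \<Rightarrow> bool" where
  "graph V E \<longleftrightarrow> finite V \<and> (\<forall>e\<in>E. \<exists>u v. e = {u, v} \<and> u \<noteq> v \<and> u \<in> V \<and> v \<in> V)"

definition is_path :: "'a set \<Rightarrow> 'a set set \<Rightarrow> 'a \<Rightarrow> 'a \<Rightarrow> 'a list \<Rightarrow> bool" where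
  "is_path V E x y p \<longleftrightarrow> p \<noteq> [] \<and> hd p = x \<and> last p = y \<and> distinct p \<and> set p \<subseteq> V
     \<and> (\<forall>i. Suc i < length p \<longrightarrow> {p ! i, p ! Suc i} \<in> E)"

definition internal :: "'a list \<Rightarrow> 'a set" where
  "internal p = set (butlast (tl p))"

definition k_vertex_connected :: "'a set \<Rightarrow> 'a set set \<Rightarrow> nat \<Rightarrow> 'a \<Rightarrow> 'a \<Rightarrow> bool" where
  "k_vertex_connected V E k x y \<longleftrightarrow>
     (\<exists>P. finite P \<and> card P = k \<and> (\<forall>p\<in>P. is_path V E x y p)
        \<and> (\<forall>p\<in>P. \<forall>q\<in>P. p \<noteq> q \<longrightarrow> internal p \<inter> internal q = {}))"

definition Qr_vertex_connected :: "'a set \<Rightarrow> 'a set set \<Rightarrow> 'a set \<Rightarrow> ('a \<Rightarrow> nat) \<Rightarrow> bool" where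
  "Qr_vertex_connected V E Q r \<longleftrightarrow> Q \<subseteq> V \<and>
     (\<forall>x\<in>Q. \<forall>y\<in>Q. x \<noteq> y \<longrightarrow> k_vertex_connected V E (min (r x) (r y)) x y)"

definition delete_vertex :: "'a set set \<Rightarrow> 'a \<Rightarrow> 'a set set" where
  "delete_vertex E v = {e \<in> E. v \<notin> e}"

text \<open>Minimality: deleting any edge, or any vertex outside Q (deleting a vertex of Q
  trivially destroys Q \<subseteq> V), violates the requirement.\<close>
definition minimal_Qr_vertex_connected :: "'a set \<Rightarrow> 'a set set \<Rightarrow> 'a set \<Rightarrow> ('a \<Rightarrow> nat) \<Rightarrow> bool" where
  "minimal_Qr_vertex_connected V E Q r \<longleftrightarrow> Qr_vertex_connected V E Q r
     \<and> (\<forall>e\<in>E. \<not> Qr_vertex_connected V (E - {e}) Q r)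
     \<and> (\<forall>v\<in>V. \<not> Qr_vertex_connected (V - {v}) (delete_vertex E v) Q r)"

definition is_cycle :: "'a set \<Rightarrow> 'a set set \<Rightarrow> 'a list \<Rightarrow> bool" where
  "is_cycle V E c \<longleftrightarrow> length c \<ge> 3 \<and> distinct c \<and> set c \<subseteq> V
     \<and> (\<forall>i. Suc i < length c \<longrightarrow> {c ! i, c ! Suc i} \<in> E) \<and> {last c, hd c} \<in> E"

end

theory Submission
  imports Defs
begin

text \<open>
  Subdividing the edges inside \<open>Q\<close> turns every minimum mixed cut between two terminals into a vertex
  separation \<open>(A, S, B)\<close>. By minimality and Menger's theorem each edge \<open>uv\<close> of a cycle avoiding \<open>Q\<close>
  is critical: some separation \<open>(A', S', B')\<close> of the graph without \<open>uv\<close> is too small. Suppose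
  a tight separation \<open>(A, S, B)\<close> has \<open>u, v \<in> S\<close>. Since \<open>u\<close> and \<open>v\<close> lie on different sides of the
  other one, comparing the sizes of the corners shows that \<open>S'\<close> meets both \<open>A\<close> and \<open>B\<close>, and then that
  \<open>S\<close> has two vertices in each of \<open>A'\<close> and \<open>B'\<close>, which is impossible as requirements are at most 3.
  Hence contracting \<open>uv\<close> preserves the requirements, and it keeps the other cycle edges critical.
  Contracting repeatedly leaves a triangle \<open>uvw\<close>; a small separation for \<open>vw\<close> contains \<open>u\<close>, so it
  survives the contraction of \<open>uv\<close>, which contradicts the requirements.
\<close>

section \<open>Menger's theorem\<close>

text \<open>Arcs are ordered pairs, since the induction for Menger's theorem removes one arc at a
  time. Vertices may repeat, so concatenation needs no distinctness check, and a single vertex of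
  \<open>A \<inter> B\<close> already counts.\<close>

definition walk :: "('a \<times> 'a) set \<Rightarrow> 'a set \<Rightarrow> 'a set \<Rightarrow> 'a list \<Rightarrow> bool" where
  "walk E A B p \<longleftrightarrow> p \<noteq> [] \<and> hd p \<in> A \<and> last p \<in> B \<and> successively (\<lambda>a b. (a, b) \<in> E) p"

definition separator :: "('a \<times> 'a) set \<Rightarrow> 'a set \<Rightarrow> 'a set \<Rightarrow> 'a set \<Rightarrow> bool" where
  "separator E A B S \<longleftrightarrow> (\<forall>p. walk E A B p \<longrightarrow> set p \<inter> S \<noteq> {})"

definition linked :: "('a \<times> 'a) set \<Rightarrow> 'a set \<Rightarrow> 'a set \<Rightarrow> nat \<Rightarrow> bool" where
  "linked E A B k \<longleftrightarrow> (\<exists>f. (\<forall>i<k. walk E A B (f i)) \<and>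
     (\<forall>i<k. \<forall>j<k. i \<noteq> j \<longrightarrow> set (f i) \<inter> set (f j) = {}))"

lemma walk_mono: "walk E A B p \<Longrightarrow> E \<subseteq> E' \<Longrightarrow> walk E' A B p"
  by (auto simp: walk_def elim: successively_mono)

section \<open>Trimming and joining walks\<close>

lemma walk_first:
  assumes "walk E A B p" "set p \<inter> P \<noteq> {}"
  obtains q where "walk E A P q" "set q \<subseteq> set p" "set (butlast q) \<inter> P = {}"
proof -
  from assms(2) obtain ys z zs where p: "p = ys @ z # zs" "z \<in> P" "\<forall>y\<in>set ys. y \<notin> P"
    using split_list_first_prop[of p "\<lambda>z. z \<in> P"] by blast
  have "walk E A P (ys @ [z])"
    using assms(1) p by (auto simp: walk_def successively_append_iff hd_append)
  then show thesis using p by (intro that[of "ys @ [z]"]) auto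
qed

lemma walk_last:
  assumes "walk E A B p" "set p \<inter> P \<noteq> {}"
  obtains q where "walk E P B q" "set q \<subseteq> set p" "set (tl q) \<inter> P = {}"
proof -
  from assms(2) obtain ys z zs where p: "p = ys @ z # zs" "z \<in> P" "\<forall>y\<in>set zs. y \<notin> P"
    using split_list_last_prop[of p "\<lambda>z. z \<in> P"] by blast
  have "walk E P B (z # zs)"
    using assms(1) p by (auto simp: walk_def successively_append_iff)
  then show thesis using p by (intro that[of "z # zs"]) auto
qed

text \<open>The arc \<open>(x, y)\<close> can only be traversed by leaving \<open>x\<close>, which
  happens at a non-final position of the walk.\<close>

lemma walk_delete_source:
  assumes "walk E A B p" "x \<notin> set (butlast p)"
  shows "walk (E - {(x, y)}) A B p"
proof -
  have "p ! i \<noteq> x" if "Suc i < length p" for i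
    using assms(2) that by (metis in_set_conv_nth length_butlast less_diff_conv nth_butlast Suc_eq_plus1)
  then show ?thesis using assms(1) by (auto simp: walk_def successively_conv_nth)
qed

lemma walk_delete_target:
  assumes "walk E A B p" "y \<notin> set (tl p)"
  shows "walk (E - {(x, y)}) A B p"
proof -
  have "p ! Suc i \<noteq> y" if "Suc i < length p" for i
    using assms(2) that
    by (metis Suc_lessE diff_Suc_1 in_set_conv_nth length_tl nth_tl)
  then show ?thesis using assms(1) by (auto simp: walk_def successively_conv_nth)
qed

lemma walk_suffix_from:
  assumes "walk E A B p" "z \<in> set p"
  obtains q where "walk E {z} B (z # q)" "set q \<subseteq> set (tl p)"
proof -
  obtain ys zs where p: "p = ys @ z # zs" using assms(2) by (meson split_list)
  have "walk E {z} B (z # zs)"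
    using assms(1) p by (auto simp: walk_def successively_append_iff)
  then show thesis using p by (intro that[of zs]) (cases ys; auto)+
qed

lemma walk_prefix_to:
  assumes "walk E A B p" "z \<in> set p"
  obtains q where "walk E A {z} (q @ [z])" "set q \<subseteq> set (butlast p)"
proof -
  obtain ys zs where p: "p = ys @ z # zs" using assms(2) by (meson split_list)
  have "walk E A {z} (ys @ [z])"
    using assms(1) p by (auto simp: walk_def successively_append_iff hd_append)
  then show thesis using p by (intro that[of ys]) (auto simp: butlast_append)
qed

lemma walk_join:
  assumes "walk E A B p" "walk E C D (z # q)" "z = last p"
  shows "walk E A D (p @ q)"
  using assms by (cases q) (auto simp: walk_def successively_append_iff)

lemma walk_append:
  assumes "walk E A B p" "walk E C D q" "(last p, hd q) \<in> E"
  shows "walk E A D (p @ q)"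
  using assms by (auto simp: walk_def successively_append_iff)

text \<open>Cutting each walk at its first vertex in \<open>P\<close> only shrinks vertex sets, so
  the family stays disjoint.\<close>

lemma linked_first:
  assumes "linked E A P k"
  obtains f where "\<And>i. i < k \<Longrightarrow> walk E A P (f i)" "\<And>i. i < k \<Longrightarrow> set (butlast (f i)) \<inter> P = {}"
    "\<And>i j. i < k \<Longrightarrow> j < k \<Longrightarrow> i \<noteq> j \<Longrightarrow> set (f i) \<inter> set (f j) = {}"
proof -
  obtain f where f: "\<And>i. i < k \<Longrightarrow> walk E A P (f i)"
    "\<And>i j. i < k \<Longrightarrow> j < k \<Longrightarrow> i \<noteq> j \<Longrightarrow> set (f i) \<inter> set (f j) = {}"
    using assms unfolding linked_def by blast
  have "\<exists>q. walk E A P q \<and> set q \<subseteq> set (f i) \<and> set (butlast q) \<inter> P = {}" if "i < k" for i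
  proof -
    have "set (f i) \<inter> P \<noteq> {}" using f(1)[OF that] last_in_set[of "f i"] unfolding walk_def by blast
    then show ?thesis using walk_first[OF f(1)[OF that]] by metis
  qed
  then obtain g where "\<And>i. i < k \<Longrightarrow> walk E A P (g i) \<and> set (g i) \<subseteq> set (f i) \<and> set (butlast (g i)) \<inter> P = {}"
    by metis
  then show thesis using f(2) by (intro that[of g]) blast+
qed

lemma linked_last:
  assumes "linked E P B k"
  obtains f where "\<And>i. i < k \<Longrightarrow> walk E P B (f i)" "\<And>i. i < k \<Longrightarrow> set (tl (f i)) \<inter> P = {}"
    "\<And>i j. i < k \<Longrightarrow> j < k \<Longrightarrow> i \<noteq> j \<Longrightarrow> set (f i) \<inter> set (f j) = {}"
proof -
  obtain f where f: "\<And>i. i < k \<Longrightarrow> walk E P B (f i)"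
    "\<And>i j. i < k \<Longrightarrow> j < k \<Longrightarrow> i \<noteq> j \<Longrightarrow> set (f i) \<inter> set (f j) = {}"
    using assms unfolding linked_def by blast
  have "\<exists>q. walk E P B q \<and> set q \<subseteq> set (f i) \<and> set (tl q) \<inter> P = {}" if "i < k" for i
  proof -
    have "set (f i) \<inter> P \<noteq> {}" using f(1)[OF that] hd_in_set[of "f i"] unfolding walk_def by blast
    then show ?thesis using walk_last[OF f(1)[OF that]] by metis
  qed
  then obtain g where "\<And>i. i < k \<Longrightarrow> walk E P B (g i) \<and> set (g i) \<subseteq> set (f i) \<and> set (tl (g i)) \<inter> P = {}"
    by metis
  then show thesis using f(2) by (intro that[of g]) blast+
qed

text \<open>Each system has as many walks as its set of meeting points has elements, so every point
  of \<open>S\<close> ends one walk of the first system and starts one of the second. These pairs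
  are joined at the common point, and the remaining pair is joined by the arc
  \<open>(x, y)\<close>.\<close>

lemma linked_glue:
  assumes f: "linked E' A (insert x S) k" and g: "linked E' (insert y S) B k"
    and S: "separator E' A B S" "finite S" and k: "k = Suc (card S)"
    and x: "x \<notin> S" and y: "y \<notin> S"
    and E: "E' \<subseteq> E" "(x, y) \<in> E"
  shows "linked E A B k"
proof -
  obtain f where f: "\<And>i. i < k \<Longrightarrow> walk E' A (insert x S) (f i)"
    "\<And>i. i < k \<Longrightarrow> set (butlast (f i)) \<inter> insert x S = {}"
    "\<And>i j. i < k \<Longrightarrow> j < k \<Longrightarrow> i \<noteq> j \<Longrightarrow> set (f i) \<inter> set (f j) = {}"
    using linked_first[OF f] by blast
  obtain g where g: "\<And>i. i < k \<Longrightarrow> walk E' (insert y S) B (g i)"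
    "\<And>i. i < k \<Longrightarrow> set (tl (g i)) \<inter> insert y S = {}"
    "\<And>i j. i < k \<Longrightarrow> j < k \<Longrightarrow> i \<noteq> j \<Longrightarrow> set (g i) \<inter> set (g j) = {}"
    using linked_last[OF g] by blast
  have ne: "f i \<noteq> []" "g i \<noteq> []" if "i < k" for i
    using f(1) g(1) that by (auto simp: walk_def)
  have fl: "last (f i) \<in> insert x S" and gh: "hd (g i) \<in> insert y S" if "i < k" for i
    using f(1) g(1) that by (auto simp: walk_def)
  have injf: "i = j" if "i < k" "j < k" "last (f i) = last (f j)" for i j
    using f(3)[OF that(1,2)] that(3) last_in_set[OF ne(1)[OF that(1)]] last_in_set[OF ne(1)[OF that(2)]]
    by (metis disjoint_iff)
  have injg: "inj_on (\<lambda>i. hd (g i)) {..<k}"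
  proof (rule inj_onI)
    fix i j assume ij: "i \<in> {..<k}" "j \<in> {..<k}" "hd (g i) = hd (g j)"
    then have "hd (g i) \<in> set (g i)" "hd (g i) \<in> set (g j)" using ne(2) hd_in_set by force+
    then show "i = j" using g(3)[of i j] ij(1,2) by blast
  qed
  \<comment> \<open>The \<open>k\<close> distinct heads lie in a set of \<open>k\<close> elements,
    so all of it is used.\<close>
  have surjg: "(\<lambda>i. hd (g i)) ` {..<k} = insert y S"
  proof (rule card_subset_eq)
    show "card ((\<lambda>i. hd (g i)) ` {..<k}) = card (insert y S)"
      using card_image[OF injg] k y S(2) by simp
  qed (use gh S(2) in auto)
  \<comment> \<open>A common vertex outside \<open>S\<close> would let a walk of \<open>E'\<close>
    switch from the first system to the second and reach \<open>B\<close> without touching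
    \<open>S\<close>.\<close>
  have meet: "z \<in> S \<and> z = last (f i) \<and> z = hd (g j)"
    if ij: "i < k" "j < k" and z: "z \<in> set (f i)" "z \<in> set (g j)" for i j z
  proof -
    have "z \<in> S"
    proof (rule ccontr)
      assume zS: "z \<notin> S"
      obtain q where q: "walk E' A {z} (q @ [z])" "set q \<subseteq> set (butlast (f i))"
        using walk_prefix_to[OF f(1)[OF ij(1)] z(1)] by metis
      obtain q' where q': "walk E' {z} B (z # q')" "set q' \<subseteq> set (tl (g j))"
        using walk_suffix_from[OF g(1)[OF ij(2)] z(2)] by metis
      have "walk E' A B ((q @ [z]) @ q')" using walk_join[OF q(1) q'(1)] by simp
      then have "set ((q @ [z]) @ q') \<inter> S \<noteq> {}" using S(1) unfolding separator_def by blast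
      then show False using q(2) q'(2) zS f(2)[OF ij(1)] g(2)[OF ij(2)] by auto
    qed
    moreover have "f i = butlast (f i) @ [last (f i)]" "g j = hd (g j) # tl (g j)" using ne ij by auto
    then have "z \<in> set (butlast (f i)) \<or> z = last (f i)" "z \<in> set (tl (g j)) \<or> z = hd (g j)"
      using z by (metis Un_iff set_append empty_iff set_ConsD empty_set, metis set_ConsD)
    ultimately show ?thesis using f(2)[OF ij(1)] g(2)[OF ij(2)] by blast
  qed
  \<comment> \<open>\<open>\<psi>\<close> sends the end of a first walk to the start of its
    continuation: points of \<open>S\<close> stay fixed, and \<open>x\<close> crosses the arc to
    \<open>y\<close>.\<close>
  define \<psi> where "\<psi> p = (if p = x then y else p)" for p
  have "\<exists>j<k. hd (g j) = \<psi> (last (f i))" if "i < k" for i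
  proof -
    have "\<psi> (last (f i)) \<in> insert y S" using fl[OF that] by (auto simp: \<psi>_def)
    then show ?thesis using surjg by (metis (no_types, lifting) imageE lessThan_iff)
  qed
  then obtain t where t: "\<And>i. i < k \<Longrightarrow> t i < k" "\<And>i. i < k \<Longrightarrow> hd (g (t i)) = \<psi> (last (f i))"
    by metis
  have injt: "i = j" if "i < k" "j < k" "t i = t j" for i j
  proof -
    have "\<psi> (last (f i)) = \<psi> (last (f j))" using t(2) that by metis
    then have "last (f i) = last (f j)" using fl[OF that(1)] fl[OF that(2)] y by (auto simp: \<psi>_def split: if_splits)
    then show ?thesis using injf that by blast
  qed
  \<comment> \<open>At \<open>x\<close> the whole second walk follows the arc; elsewhere its head is
    already the last vertex of the first walk and is dropped.\<close>
  define h where "h i = f i @ (if last (f i) = x then g (t i) else tl (g (t i)))" for i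
  have hset: "set (h i) \<subseteq> set (f i) \<union> set (g (t i))" for i
    by (auto simp: h_def dest: list.set_sel(2)[rotated])
       (metis list.set_sel(2) tl_Nil)
  have "walk E A B (h i)" if i: "i < k" for i
  proof -
    note wf = walk_mono[OF f(1)[OF i] E(1)] and wg = walk_mono[OF g(1)[OF t(1)[OF i]] E(1)]
    show ?thesis
    proof (cases "last (f i) = x")
      case True
      then show ?thesis using walk_append[OF wf wg] t(2)[OF i] E(2) by (simp add: h_def \<psi>_def)
    next
      case False
      have "g (t i) = last (f i) # tl (g (t i))"
        using t(2)[OF i] False ne(2)[OF t(1)[OF i]] by (metis \<psi>_def list.collapse)
      then show ?thesis using walk_join[OF wf, of _ _ "last (f i)" "tl (g (t i))"] wg False
        by (simp add: h_def)
    qed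
  qed
  moreover have "set (h i) \<inter> set (h j) = {}" if ij: "i < k" "j < k" "i \<noteq> j" for i j
  proof -
    \<comment> \<open>A shared vertex would lie in \<open>S\<close>, where \<open>\<psi>\<close> is
      the identity, and would force the walks \<open>f i\<close> and \<open>f j\<close> to end at
      the same point.\<close>
    have *: "set (f i) \<inter> set (g (t j)) = {}" if ij: "i < k" "j < k" "i \<noteq> j" for i j
    proof (rule ccontr)
      assume "\<not> ?thesis"
      then obtain z where "z \<in> set (f i)" "z \<in> set (g (t j))" by blast
      then have z: "z \<in> S" "z = last (f i)" "z = hd (g (t j))" using meet[of i "t j"] t(1) ij by blast+
      then have "\<psi> (last (f i)) = hd (g (t j))" using x by (auto simp: \<psi>_def)
      then have "\<psi> (last (f i)) = \<psi> (last (f j))" using t(2) ij by simp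
      then have "last (f i) = last (f j)" using fl[OF ij(1)] fl[OF ij(2)] y by (auto simp: \<psi>_def split: if_splits)
      then show False using injf ij by blast
    qed
    have "set (f i) \<inter> set (f j) = {}" using f(3) ij .
    moreover have "t i \<noteq> t j" using injt[OF ij(1,2)] ij(3) by metis
    then have "set (g (t i)) \<inter> set (g (t j)) = {}" by (rule g(3)[OF t(1)[OF ij(1)] t(1)[OF ij(2)]])
    moreover have "set (f i) \<inter> set (g (t j)) = {}" "set (f j) \<inter> set (g (t i)) = {}"
      using *[OF ij] *[OF ij(2,1)] ij(3) by auto
    ultimately show ?thesis using hset[of i] hset[of j] by blast
  qed
  ultimately show ?thesis unfolding linked_def by blast
qed

lemma linked_mono: "linked E A B k \<Longrightarrow> E \<subseteq> E' \<Longrightarrow> linked E' A B k"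
  unfolding linked_def using walk_mono by metis

lemma separator_empty: "separator {} A B (A \<inter> B)"
proof -
  have "set p \<inter> (A \<inter> B) \<noteq> {}" if "walk {} A B p" for p
  proof -
    have "p = [hd p]" using that by (cases p; cases "tl p") (auto simp: walk_def)
    then show ?thesis using that by (auto simp: walk_def) (metis disjoint_iff hd_in_set last_ConsL IntI)
  qed
  then show ?thesis by (simp add: separator_def)
qed

text \<open>Goering's proof: induction on the number of arcs.\<close>

theorem menger:
  assumes "finite E" "finite A" "finite B"
    and "\<And>S. finite S \<Longrightarrow> separator E A B S \<Longrightarrow> k \<le> card S"
  shows "linked E A B k"
  using assms
proof (induction E arbitrary: A B rule: finite_remove_induct)
  case empty
  then have "k \<le> card (A \<inter> B)" using separator_empty by (metis finite_Int)
  then obtain T where T: "T \<subseteq> A \<inter> B" "card T = k" "finite T"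
    by (metis obtain_subset_with_card_n)
  then obtain b where b: "bij_betw b {..<k} T"
    by (metis ex_bij_betw_nat_finite lessThan_atLeast0)
  show ?case unfolding linked_def
  proof (intro exI conjI allI impI)
    fix i assume "i < k"
    then have "b i \<in> T" using b by (auto simp: bij_betw_def)
    then show "walk {} A B [b i]" using T by (auto simp: walk_def)
  next
    fix i j assume "i < k" "j < k" "i \<noteq> j"
    then show "set [b i] \<inter> set [b j] = {}" using b by (auto simp: bij_betw_def inj_on_def)
  qed
next
  case (remove E)
  obtain x y where xy: "(x, y) \<in> E" using remove.hyps by auto
  define E' where "E' = E - {(x, y)}"
  note IH = remove.IH[OF xy, folded E'_def]
  show ?case
  proof (cases "linked E' A B k")
    case True
    then show ?thesis by (rule linked_mono) (auto simp: E'_def)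
  next
    case False
    then obtain S where S: "finite S" "separator E' A B S" "card S < k"
      using IH[OF remove.prems(1,2)] by (meson not_le)
    have hitx: "set p \<inter> insert x S \<noteq> {}" if "walk E A B p" for p
    proof (cases "x \<in> set p")
      case False
      then have "walk E' A B p" using walk_delete_source[OF that, of x] in_set_butlastD
        by (fastforce simp: E'_def)
      then show ?thesis using S(2) by (auto simp: separator_def)
    qed auto
    have hity: "set p \<inter> insert y S \<noteq> {}" if "walk E A B p" for p
    proof (cases "y \<in> set p")
      case False
      then have "walk E' A B p" using walk_delete_target[OF that, of y] list.set_sel(2)
        by (metis E'_def tl_Nil)
      then show ?thesis using S(2) by (auto simp: separator_def)
    qed auto
    \<comment> \<open>Both enlarged sets separate in the full \<open>E\<close>; together with
      \<open>card S < k\<close> this pins \<open>card S\<close> to \<open>k - 1\<close> and keeps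
      \<open>x\<close> and \<open>y\<close> out of \<open>S\<close>.\<close>
    have "k \<le> card (insert x S)" "k \<le> card (insert y S)"
      using hitx hity S(1) by (auto intro!: remove.prems(3) simp: separator_def)
    then have k: "k = Suc (card S)" "x \<notin> S" "y \<notin> S"
      using S by (auto simp: card_insert_if split: if_splits)
    have "linked E' A (insert x S) k"
    proof (rule IH)
      fix T assume T: "finite T" "separator E' A (insert x S) T"
      \<comment> \<open>Up to its first vertex in \<open>insert x S\<close> the walk cannot have
        used the removed arc, so this initial part is a walk of \<open>E'\<close> and meets
        \<open>T\<close>.\<close>
      have "set p \<inter> T \<noteq> {}" if p: "walk E A B p" for p
      proof -
        obtain q where q: "walk E A (insert x S) q" "set q \<subseteq> set p" "set (butlast q) \<inter> insert x S = {}"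
          using walk_first[OF p hitx[OF p]] by blast
        have "walk E' A (insert x S) q" using walk_delete_source[OF q(1), of x y] q(3) by (auto simp: E'_def)
        then show ?thesis using T(2) q(2) unfolding separator_def by blast
      qed
      then show "k \<le> card T" using T(1) by (intro remove.prems(3)) (auto simp: separator_def)
    qed (use S(1) remove.prems in auto)
    moreover have "linked E' (insert y S) B k"
    proof (rule IH)
      fix T assume T: "finite T" "separator E' (insert y S) B T"
      have "set p \<inter> T \<noteq> {}" if p: "walk E A B p" for p
      proof -
        obtain q where q: "walk E (insert y S) B q" "set q \<subseteq> set p" "set (tl q) \<inter> insert y S = {}"
          using walk_last[OF p hity[OF p]] by blast
        have "walk E' (insert y S) B q" using walk_delete_target[OF q(1), of y x] q(3) by (auto simp: E'_def)
        then show ?thesis using T(2) q(2) unfolding separator_def by blast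
      qed
      then show "k \<le> card T" using T(1) by (intro remove.prems(3)) (auto simp: separator_def)
    qed (use S(1) remove.prems in auto)
    ultimately show ?thesis
      using linked_glue[of E' A x S k y B E] S k xy by (auto simp: E'_def)
  qed
qed

section \<open>Mixed cuts\<close>

lemma walk_distinct:
  assumes "walk E A B p"
  obtains q where "walk E A B q" "set q \<subseteq> set p" "distinct q"
proof -
  have "\<exists>q. walk E A B q \<and> set q \<subseteq> set p \<and> distinct q"
    using assms
  proof (induction "length p" arbitrary: p rule: less_induct)
    case less
    show ?case
    proof (cases "distinct p")
      case True
      then show ?thesis using less.prems by blast
    next
      case False
      then obtain xs ys zs z where p: "p = xs @ [z] @ ys @ [z] @ zs"
        using not_distinct_decomp by blast
      have "walk E A B (xs @ [z] @ zs)"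
        using less.prems p by (auto simp: walk_def successively_append_iff hd_append successively_Cons)
      moreover have "length (xs @ [z] @ zs) < length p" using p by simp
      ultimately obtain q where "walk E A B q" "set q \<subseteq> set (xs @ [z] @ zs)" "distinct q"
        using less.hyps by meson
      then show ?thesis using p by auto
    qed
  qed
  then show thesis using that by blast
qed

lemma graph_edge:
  assumes "graph V E" "{a, b} \<in> E"
  shows "a \<in> V" "b \<in> V" "a \<noteq> b"
  using assms unfolding graph_def by (metis doubleton_eq_iff)+

text \<open>Removing \<open>x\<close> and \<open>y\<close> turns internally disjoint paths into
  fully disjoint walks between their neighbourhoods. Attaching the two ends gives \<open>l\<close>
  paths, and an edge \<open>xy\<close> contributes one more.\<close>

lemma linked_imp_k_vertex_connected:
  fixes E :: "'a set set"
  defines "D x y \<equiv> {(a, b). {a, b} \<in> E \<and> a \<notin> {x, y} \<and> b \<notin> {x, y}}"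
  assumes G: "graph V E" and xy: "x \<in> V" "y \<in> V" "x \<noteq> y"
    and k: "k = l + (if {x, y} \<in> E then 1 else 0)"
    and L: "linked (D x y) {a. {x, a} \<in> E \<and> a \<noteq> y} {a. {a, y} \<in> E \<and> a \<noteq> x} l"
  shows "k_vertex_connected V E k x y"
proof -
  let ?A = "{a. {x, a} \<in> E \<and> a \<noteq> y}" and ?B = "{a. {a, y} \<in> E \<and> a \<noteq> x}"
  obtain f where f: "\<And>i. i < l \<Longrightarrow> walk (D x y) ?A ?B (f i)"
    "\<And>i j. i < l \<Longrightarrow> j < l \<Longrightarrow> i \<noteq> j \<Longrightarrow> set (f i) \<inter> set (f j) = {}"
    using L unfolding linked_def by blast
  have "\<exists>q. walk (D x y) ?A ?B q \<and> set q \<subseteq> set (f i) \<and> distinct q" if "i < l" for i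
    by (rule walk_distinct[OF f(1)[OF that]]) blast
  then have "\<forall>i\<in>{..<l}. \<exists>q. walk (D x y) ?A ?B q \<and> set q \<subseteq> set (f i) \<and> distinct q" by blast
  then obtain g where "\<forall>i\<in>{..<l}. walk (D x y) ?A ?B (g i) \<and> set (g i) \<subseteq> set (f i) \<and> distinct (g i)"
    by (rule bchoice[THEN exE])
  then have g: "\<And>i. i < l \<Longrightarrow> walk (D x y) ?A ?B (g i)" "\<And>i. i < l \<Longrightarrow> set (g i) \<subseteq> set (f i)"
    "\<And>i. i < l \<Longrightarrow> distinct (g i)"
    by blast+
  have dis: "set (g i) \<inter> set (g j) = {}" if "i < l" "j < l" "i \<noteq> j" for i j
    using f(2)[OF that] g(2) that by blast
  have gne: "g i \<noteq> []" if "i < l" for i using g(1)[OF that] by (simp add: walk_def)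
  have gV: "set (g i) \<subseteq> V - {x, y}" if "i < l" for i
  proof
    fix z assume z: "z \<in> set (g i)"
    have w: "walk (D x y) ?A ?B (g i)" using g(1)[OF that] .
    from z obtain n where n: "n < length (g i)" "z = g i ! n" by (metis in_set_conv_nth)
    show "z \<in> V - {x, y}"
    proof (cases n)
      case 0
      then have "z = hd (g i)" using n gne[OF that] by (simp add: hd_conv_nth)
      then show ?thesis using w graph_edge[OF G, of x z] by (auto simp: walk_def)
    next
      case (Suc m)
      then have "(g i ! m, g i ! Suc m) \<in> D x y" using w n by (auto simp: walk_def successively_conv_nth)
      then show ?thesis using n Suc graph_edge[OF G] by (auto simp: D_def)
    qed
  qed
  have path: "is_path V E x y (x # g i @ [y])" if "i < l" for i
  proof -
    have w: "walk (D x y) ?A ?B (g i)" using g(1)[OF that] .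
    have "successively (\<lambda>a b. {a, b} \<in> E) (g i)"
      using w by (auto simp: walk_def D_def elim: successively_mono)
    then have "successively (\<lambda>a b. {a, b} \<in> E) (x # g i @ [y])"
      using w by (auto simp: walk_def successively_append_iff successively_Cons)
    then show ?thesis using xy gV[OF that] g(3)[OF that]
      by (auto simp: is_path_def successively_conv_nth simp del: length_Cons length_append)
  qed
  define P where "P = (\<lambda>i. x # g i @ [y]) ` {..<l} \<union> (if {x, y} \<in> E then {[x, y]} else {})"
  have inj: "inj_on (\<lambda>i. x # g i @ [y]) {..<l}"
    using dis gne by (intro inj_onI) (metis append_same_eq inf.idem lessThan_iff list.inject set_empty)
  have "card ((\<lambda>i. x # g i @ [y]) ` {..<l}) = l" using card_image[OF inj] by simp
  moreover have "[x, y] \<notin> (\<lambda>i. x # g i @ [y]) ` {..<l}" using gne by auto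
  ultimately have "card P = k" "finite P" by (auto simp: P_def k)
  moreover have "is_path V E x y p" if "p \<in> P" for p
  proof -
    have "is_path V E x y [x, y]" if "{x, y} \<in> E" using that xy by (simp add: is_path_def)
    then show ?thesis using that path unfolding P_def by (auto split: if_splits)
  qed
  moreover have "internal p \<inter> internal q = {}" if "p \<in> P" "q \<in> P" "p \<noteq> q" for p q
    using that dis by (auto simp: P_def internal_def butlast_append split: if_splits) blast+
  ultimately show ?thesis unfolding k_vertex_connected_def by blast
qed

text \<open>No vertex set separates adjacent vertices, so a possible edge \<open>xy\<close> is
  itself part of the cut: it may leave \<open>A\<close> freely but is counted once next to
  \<open>S\<close>.\<close>

lemma menger_mixed:
  assumes G: "graph V E" and xy: "x \<in> V" "y \<in> V" "x \<noteq> y"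
    and nk: "\<not> k_vertex_connected V E k x y"
  obtains A S where "finite S" "A \<inter> S = {}" "x \<in> A" "y \<notin> A \<union> S"
    "\<And>a b. a \<in> A \<Longrightarrow> {a, b} \<in> E \<Longrightarrow> b \<in> A \<union> S \<or> {a, b} = {x, y}"
    "card S + (if {x, y} \<in> E then 1 else 0) < k"
proof -
  define D where "D = {(a, b). {a, b} \<in> E \<and> a \<notin> {x, y} \<and> b \<notin> {x, y}}"
  define c :: nat where "c = (if {x, y} \<in> E then 1 else 0)"
  let ?A = "{a. {x, a} \<in> E \<and> a \<noteq> y}" and ?B = "{a. {a, y} \<in> E \<and> a \<noteq> x}"
  have V: "finite V" using G by (simp add: graph_def)
  have fin: "finite D" "finite ?A" "finite ?B"
    by (rule finite_subset[of _ "V \<times> V"] finite_subset[of _ V];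
        use graph_edge[OF G] V in \<open>auto simp: D_def\<close>)+
  \<comment> \<open>Otherwise \<open>k = 0\<close>, or \<open>k = 1\<close> and the edge
    \<open>xy\<close> is the one path required. This makes the natural-number subtraction
    \<open>k - c\<close> below exact.\<close>
  have "c < k"
  proof (rule ccontr)
    assume "\<not> c < k"
    then have "k = 0 \<or> k = 1 \<and> {x, y} \<in> E" by (cases k) (auto simp: c_def split: if_splits)
    then consider "k = 0" | "k = 1" "{x, y} \<in> E" by blast
    then show False
    proof cases
      case 1
      then have "k_vertex_connected V E k x y"
        unfolding k_vertex_connected_def by (intro exI[of _ "{}"]) auto
      then show False using nk by simp
    next
      case 2
      then have "k_vertex_connected V E k x y"
        unfolding k_vertex_connected_def using xy
        by (intro exI[of _ "{[x, y]}"]) (auto simp: is_path_def)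
      then show False using nk by simp
    qed
  qed
  then have "k = (k - c) + c" by simp
  then have "\<not> linked D ?A ?B (k - c)"
    using linked_imp_k_vertex_connected[OF G xy, of k "k - c"] nk unfolding D_def c_def by auto
  then obtain S0 where S0: "finite S0" "separator D ?A ?B S0" "card S0 < k - c"
    using menger[OF fin] by (meson not_le)
  define S where "S = S0 - {x, y}"
  have av: "set p \<inter> {x, y} = {}" if "walk D ?A X p" for p X
  proof -
    have "z \<notin> {x, y}" if z: "z \<in> set p" for z
    proof -
      from z obtain n where n: "n < length p" "z = p ! n" by (metis in_set_conv_nth)
      show ?thesis
      proof (cases n)
        case 0
        then have "z = hd p" using n by (cases p) auto
        then show ?thesis using that(1) \<open>walk D ?A X p\<close> graph_edge[OF G, of x z] by (auto simp: walk_def)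
      next
        case (Suc m)
        then have "(p ! m, p ! Suc m) \<in> D" using \<open>walk D ?A X p\<close> n by (auto simp: walk_def successively_conv_nth)
        then show ?thesis using n Suc by (auto simp: D_def)
      qed
    qed
    then show ?thesis by blast
  qed
  have sep: "set p \<inter> S \<noteq> {}" if "walk D ?A ?B p" for p
    using S0(2) that av[OF that] by (auto simp: separator_def S_def)
  \<comment> \<open>Together with \<open>x\<close> itself, the vertices reachable from
    \<open>x\<close> past \<open>S\<close> form the side \<open>A\<close> of the cut.\<close>
  define R where "R = {z. \<exists>p. walk D ?A {z} p \<and> set p \<inter> S = {}}"
  have RS: "R \<inter> S = {}" by (auto simp: R_def walk_def) (metis disjoint_iff last_in_set)
  have Rxy: "R \<inter> {x, y} = {}"
    using av by (auto simp: R_def walk_def) (metis (mono_tags) disjoint_iff insertCI last_in_set)+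
  have RB: "R \<inter> ?B = {}"
  proof (rule ccontr)
    assume "\<not> ?thesis"
    then obtain z p where "walk D ?A {z} p" "set p \<inter> S = {}" "z \<in> ?B" unfolding R_def by blast
    then have "walk D ?A ?B p" by (auto simp: walk_def)
    then show False using sep \<open>set p \<inter> S = {}\<close> by blast
  qed
  show thesis
  proof (rule that[of S "insert x R"])
    show "finite S" using S0(1) by (simp add: S_def)
    show "insert x R \<inter> S = {}" using RS by (auto simp: S_def)
    show "y \<notin> insert x R \<union> S" using Rxy xy by (auto simp: S_def)
    have "card S \<le> card S0" using S0(1) by (simp add: S_def card_Diff_subset_Int card_mono)
    then show "card S + (if {x, y} \<in> E then 1 else 0) < k" using S0(3) by (simp add: c_def)
    fix a b assume a: "a \<in> insert x R" and ab: "{a, b} \<in> E"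
    show "b \<in> insert x R \<union> S \<or> {a, b} = {x, y}"
    proof (cases "a = x")
      case True
      show ?thesis
      proof (cases "b = y \<or> b \<in> S")
        case False
        then have "walk D ?A {b} [b]" using True ab by (auto simp: walk_def)
        then show ?thesis using False unfolding R_def by (auto intro!: exI[of _ "[b]"])
      qed (use True in auto)
    next
      case False
      then have aR: "a \<in> R" using a by blast
      then have "b \<noteq> y" using RB ab False by auto
      then show ?thesis
      proof (cases "b = x \<or> b \<in> S")
        case False
        obtain p where p: "walk D ?A {a} p" "set p \<inter> S = {}" using aR by (auto simp: R_def)
        have "(a, b) \<in> D" using aR Rxy ab False \<open>b \<noteq> y\<close> by (auto simp: D_def)
        then have "walk D ?A {b} (p @ [b])"
          using p(1) by (auto simp: walk_def successively_append_iff)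
        then show ?thesis using False p(2) unfolding R_def by (auto intro!: exI[of _ "p @ [b]"])
      qed auto
    qed
  qed simp
qed

section \<open>Separations and contraction\<close>

text \<open>The three parts cover the whole type, so a contraction needs no change of carrier. Only
  \<open>S\<close> has to be finite, and for symmetric \<open>R\<close> excluding edges from
  \<open>A\<close> to \<open>B\<close> suffices.\<close>

definition separation :: "('b \<Rightarrow> 'b \<Rightarrow> bool) \<Rightarrow> 'b set \<Rightarrow> 'b set \<Rightarrow> 'b set \<Rightarrow> bool" where
  "separation R A S B \<longleftrightarrow> finite S \<and> A \<inter> S = {} \<and> B \<inter> S = {} \<and> A \<inter> B = {} \<and> A \<union> S \<union> B = UNIV
     \<and> (\<forall>a\<in>A. \<forall>b\<in>B. \<not> R a b)"

text \<open>The cut form of the connectivity requirement. Unlike systems of paths, cuts are easily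
  carried along contractions by taking images and preimages.\<close>

definition meets_req :: "('b \<Rightarrow> 'b \<Rightarrow> bool) \<Rightarrow> 'b set \<Rightarrow> ('b \<Rightarrow> nat) \<Rightarrow> bool" where
  "meets_req R Q r \<longleftrightarrow> (\<forall>A S B. \<forall>x\<in>Q \<inter> A. \<forall>y\<in>Q \<inter> B. separation R A S B \<longrightarrow> min (r x) (r y) \<le> card S)"

definition delete :: "('b \<Rightarrow> 'b \<Rightarrow> bool) \<Rightarrow> 'b \<Rightarrow> 'b \<Rightarrow> 'b \<Rightarrow> 'b \<Rightarrow> bool" where
  "delete R u v = (\<lambda>a b. R a b \<and> {a, b} \<noteq> {u, v})"

definition critical :: "('b \<Rightarrow> 'b \<Rightarrow> bool) \<Rightarrow> 'b set \<Rightarrow> ('b \<Rightarrow> nat) \<Rightarrow> 'b \<Rightarrow> 'b \<Rightarrow> bool" where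
  "critical R Q r u v \<longleftrightarrow> (\<exists>A S B. \<exists>x\<in>Q \<inter> A. \<exists>y\<in>Q \<inter> B.
     separation (delete R u v) A S B \<and> card S < min (r x) (r y))"

text \<open>Contraction leaves \<open>v\<close> behind as an isolated vertex and may create a loop at \<open>u\<close>; neither
  affects separations.\<close>

definition contract :: "('b \<Rightarrow> 'b \<Rightarrow> bool) \<Rightarrow> 'b \<Rightarrow> 'b \<Rightarrow> 'b \<Rightarrow> 'b \<Rightarrow> bool" where
  "contract R u v = (\<lambda>a b. \<exists>a' b'. R a' b' \<and> (id(v := u)) a' = a \<and> (id(v := u)) b' = b)"

lemma symp_delete: "symp R \<Longrightarrow> symp (delete R u v)"
  by (auto simp: symp_def delete_def insert_commute)

lemma symp_contract: "symp R \<Longrightarrow> symp (contract R u v)"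
  unfolding symp_def contract_def by metis

lemma separation_sym: "symp R \<Longrightarrow> separation R A S B \<Longrightarrow> separation R B S A"
  unfolding separation_def by (auto dest: sympD)

lemma separationD:
  assumes "separation R A S B"
  shows "finite S" "x \<in> A \<Longrightarrow> x \<notin> S" "x \<in> A \<Longrightarrow> x \<notin> B" "x \<in> B \<Longrightarrow> x \<notin> S" "x \<in> B \<Longrightarrow> x \<notin> A"
    "x \<notin> S \<Longrightarrow> x \<notin> B \<Longrightarrow> x \<in> A" "x \<notin> S \<Longrightarrow> x \<notin> A \<Longrightarrow> x \<in> B" "x \<notin> A \<Longrightarrow> x \<notin> B \<Longrightarrow> x \<in> S"
    "x \<in> A \<Longrightarrow> y \<in> B \<Longrightarrow> \<not> R x y"
  using assms unfolding separation_def by blast+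

lemma separation_edge:
  assumes "separation R A S B" "a \<in> A" "R a b"
  shows "b \<in> A \<union> S"
proof -
  have "b \<notin> B" "b \<in> A \<union> S \<union> B" using assms unfolding separation_def by blast+
  then show ?thesis by blast
qed

lemma meets_reqD:
  assumes "meets_req R Q r" "separation R A S B" "x \<in> Q" "x \<in> A" "y \<in> Q" "y \<in> B"
  shows "min (r x) (r y) \<le> card S"
  using assms unfolding meets_req_def by blast

section \<open>Critical edges and the uncrossing of separations\<close>

text \<open>The violating separation is too small to be one of \<open>R\<close>, so the deleted edge
  must cross it. Swapping the sides puts \<open>u\<close> in \<open>A\<close>.\<close>

lemma critical_cut:
  assumes "symp R" "meets_req R Q r" "critical R Q r u v"
  obtains A S B x y where "separation (delete R u v) A S B" "x \<in> Q" "x \<in> A" "y \<in> Q" "y \<in> B"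
    "card S < min (r x) (r y)" "u \<in> A" "v \<in> B"
proof -
  obtain A S B x y where c: "separation (delete R u v) A S B" "x \<in> Q" "x \<in> A" "y \<in> Q" "y \<in> B"
    "card S < min (r x) (r y)" using assms(3) unfolding critical_def by blast
  have "\<not> separation R A S B" using meets_reqD[OF assms(2) _ c(2-5), of S] c(6) by linarith
  then have "u \<in> A \<and> v \<in> B \<or> v \<in> A \<and> u \<in> B"
    using c(1) unfolding separation_def delete_def by (auto simp: doubleton_eq_iff)
  then show thesis
  proof
    assume "u \<in> A \<and> v \<in> B"
    then show ?thesis using that[OF c] by blast
  next
    assume vu: "v \<in> A \<and> u \<in> B"
    have "card S < min (r y) (r x)" using c(6) by (subst min.commute)
    then show ?thesis
      using that[OF separation_sym[OF symp_delete[OF assms(1)] c(1)] c(4,5,2,3)] vu by blast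
  qed
qed

text \<open>The corner \<open>A \<inter> A'\<close> has its neighbours in the three pieces counted
  on the right. Although \<open>S'\<close> separates only after deleting \<open>uv\<close>, that
  edge does not touch the corner because both its ends lie in \<open>S\<close>, so the result is a
  separation of \<open>R\<close> itself.\<close>

lemma corner_bound:
  assumes "meets_req R Q r" "separation R A S B" "separation (delete R u v) A' S' B'"
    and "u \<in> S" "v \<in> S" "p \<in> Q" "p \<in> A \<inter> A'" "q \<in> Q" "q \<notin> A \<inter> A'" "q \<notin> S \<inter> A'" "q \<notin> S \<inter> S'" "q \<notin> S' \<inter> A"
  shows "min (r p) (r q) \<le> card (S \<inter> A') + card (S \<inter> S') + card (S' \<inter> A)"
proof -
  let ?N = "(S \<inter> A') \<union> (S \<inter> S') \<union> (S' \<inter> A)"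
  have "\<not> R a b" if ab: "a \<in> A \<inter> A'" "b \<notin> A \<inter> A'" "b \<notin> ?N" for a b
  proof
    assume "R a b"
    then have "b \<in> A \<union> S" using ab separation_edge[OF assms(2)] by blast
    moreover have "a \<noteq> u" "a \<noteq> v" using ab assms(2,4,5) unfolding separation_def by blast+
    then have "delete R u v a b" using \<open>R a b\<close> by (auto simp: delete_def doubleton_eq_iff)
    then have "b \<in> A' \<union> S'" using ab separation_edge[OF assms(3)] by blast
    ultimately show False using ab by blast
  qed
  moreover have "finite ?N" "A \<inter> A' \<inter> ?N = {}"
    using assms(2,3) unfolding separation_def by blast+
  ultimately have sep: "separation R (A \<inter> A') ?N (- (A \<inter> A') - ?N)"
    unfolding separation_def by blast
  have "min (r p) (r q) \<le> card ?N"
    by (rule meets_reqD[OF assms(1) sep assms(6,7,8)]) (use assms(9-12) in blast)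
  also have "\<dots> \<le> card (S \<inter> A') + card (S \<inter> S') + card (S' \<inter> A)"
    using card_Un_le[of "(S \<inter> A') \<union> (S \<inter> S')" "S' \<inter> A"] card_Un_le[of "S \<inter> A'" "S \<inter> S'"] by linarith
  finally show ?thesis .
qed

text \<open>A tight separation through both ends of a critical edge is uncrossed with the separation
  obtained by deleting the edge. The corner bounds force at least four vertices into
  \<open>S\<close>, while tightness allows at most three.\<close>

lemma critical_separation_larger:
  assumes R: "symp R" "meets_req R Q r" and r: "\<forall>q\<in>Q. r q \<le> 3"
    and crit: "critical R Q r u v" and uv: "u \<notin> Q" "v \<notin> Q"
    and sep: "separation R A S B" "x \<in> Q" "x \<in> A" "y \<in> Q" "y \<in> B" and S: "u \<in> S" "v \<in> S"
  shows "min (r x) (r y) < card S"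
proof (rule ccontr)
  assume "\<not> ?thesis"
  then have le: "card S \<le> min (r x) (r y)" by (rule leI)
  obtain A' S' B' x' y' where c: "separation (delete R u v) A' S' B'" "x' \<in> Q" "x' \<in> A'" "y' \<in> Q" "y' \<in> B'"
    "card S' < min (r x') (r y')" "u \<in> A'" "v \<in> B'" using critical_cut[OF R crit] by blast
  note sep' = separation_sym[OF R(1) sep(1)] and c' = separation_sym[OF symp_delete[OF R(1)] c(1)]
  have fin: "finite S" "finite S'" using sep c by (auto simp: separation_def)
  have cS: "card S = card (S \<inter> A') + card (S \<inter> S') + card (S \<inter> B')"
  proof -
    have "S = (S \<inter> A') \<union> (S \<inter> S') \<union> (S \<inter> B')" using c(1) by (auto simp: separation_def)
    also have "card \<dots> = card (S \<inter> A') + card (S \<inter> S') + card (S \<inter> B')"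
      using fin c(1) by (subst card_Un_disjoint; (subst card_Un_disjoint)?) (auto simp: separation_def)
    finally show ?thesis .
  qed
  have cS': "card S' = card (S' \<inter> A) + card (S \<inter> S') + card (S' \<inter> B)"
  proof -
    have "S' = (S' \<inter> A) \<union> (S \<inter> S') \<union> (S' \<inter> B)" using sep(1) by (auto simp: separation_def)
    also have "card \<dots> = card (S' \<inter> A) + card (S \<inter> S') + card (S' \<inter> B)"
      using fin sep(1) by (subst card_Un_disjoint; (subst card_Un_disjoint)?) (auto simp: separation_def)
    finally show ?thesis .
  qed
  have pos: "card (S \<inter> A') > 0" "card (S \<inter> B') > 0"
    using fin S c by (auto simp: card_gt_0_iff)
  \<comment> \<open>A terminal of \<open>Y\<close> outside \<open>S'\<close> lies in a corner, say
    with \<open>A'\<close>. Comparing the corner bound with the decomposition of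
    \<open>card S\<close> gives \<open>S' \<inter> Y\<close> at least as many vertices as
    \<open>S \<inter> B'\<close>, which is nonempty.\<close>
  have side: "card (S' \<inter> Y) > 0"
    if s: "separation R Y S X" "y \<in> Q" "y \<in> Y" "x \<in> Q" "x \<in> X" "card S \<le> min (r y) (r x)" for X Y x y
  proof (cases "y \<in> S'")
    case True
    then show ?thesis using fin s by (auto simp: card_gt_0_iff)
  next
    case False
    have xnot: "x \<notin> Y" "x \<notin> S" using s by (auto simp: separation_def)
    have "y \<in> A' \<or> y \<in> B'" using False c(1) by (auto simp: separation_def)
    then show ?thesis
    proof
      assume "y \<in> A'"
      then have "min (r y) (r x) \<le> card (S \<inter> A') + card (S \<inter> S') + card (S' \<inter> Y)"
        using corner_bound[OF R(2) s(1) c(1) S, of y x] s xnot by auto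
      then show ?thesis using s(6) cS pos by linarith
    next
      assume "y \<in> B'"
      then have "min (r y) (r x) \<le> card (S \<inter> B') + card (S \<inter> S') + card (S' \<inter> Y)"
        using corner_bound[OF R(2) s(1) c' S, of y x] s xnot by auto
      then show ?thesis using s(6) cS pos by linarith
    qed
  qed
  have "card (S' \<inter> A) > 0" using side[OF sep(1) sep(2-5)] le by simp
  moreover have "card (S' \<inter> B) > 0" using side[OF sep' sep(4,5,2,3)] le by (simp add: min.commute)
  moreover have "r x' \<le> 3" "r y' \<le> 3" "r x \<le> 3" "r y \<le> 3" using r c sep by auto
  \<comment> \<open>\<open>S'\<close> has at most two vertices, and each of \<open>A\<close> and
    \<open>B\<close> claims one of them.\<close>
  ultimately have eq: "card (S' \<inter> A) = 1" "card (S' \<inter> B) = 1" "card (S \<inter> S') = 0" "min (r x') (r y') = 3"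
    using cS' c(6) by linarith+
  \<comment> \<open>A terminal of \<open>X\<close> inside \<open>S\<close> differs from the
    non-terminal \<open>z\<close>, which gives two vertices. Outside \<open>S\<close>, the corner
    bound 3 loses only one vertex to \<open>S'\<close>.\<close>
  have side': "card (S \<inter> X) \<ge> 2"
    if s: "separation (delete R u v) X S' Y" "x \<in> Q" "x \<in> X" "y \<in> Q" "y \<in> Y" "min (r x) (r y) = 3"
      and z: "z \<in> S \<inter> X" "z \<notin> Q" for X Y x y z
  proof -
    have ynot: "y \<notin> X" "y \<notin> S'" using s by (auto simp: separation_def)
    have "x \<in> S \<or> x \<in> A \<or> x \<in> B" using sep(1) by (auto simp: separation_def)
    then show ?thesis
    proof (elim disjE)
      assume "x \<in> S"
      then have "{x, z} \<subseteq> S \<inter> X" "x \<noteq> z" using s z by auto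
      then show ?thesis using card_mono[of "S \<inter> X" "{x, z}"] fin by auto
    next
      assume "x \<in> A"
      then have "min (r x) (r y) \<le> card (S \<inter> X) + card (S \<inter> S') + card (S' \<inter> A)"
        using corner_bound[OF R(2) sep(1) s(1) S, of x y] s ynot by auto
      then show ?thesis using s(6) eq by linarith
    next
      assume "x \<in> B"
      then have "min (r x) (r y) \<le> card (S \<inter> X) + card (S \<inter> S') + card (S' \<inter> B)"
        using corner_bound[OF R(2) sep' s(1) S, of x y] s ynot by auto
      then show ?thesis using s(6) eq by linarith
    qed
  qed
  have "card (S \<inter> A') \<ge> 2" using side'[OF c(1-5), of u] eq S uv c by auto
  moreover have "card (S \<inter> B') \<ge> 2" using side'[OF c' c(4,5,2,3), of v] eq S uv c by (auto simp: min.commute)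
  ultimately show False using cS le \<open>r x \<le> 3\<close> by linarith
qed

section \<open>Contracting along a cycle of critical edges\<close>

text \<open>A separation of the contraction pulls back to one of \<open>R\<close>. It can grow only
  by \<open>v\<close>, and only if \<open>u\<close> is in \<open>S\<close>; then both ends lie in
  the pulled-back separator, which by the uncrossing lemma has a vertex to spare.\<close>

lemma meets_req_contract:
  assumes R: "symp R" "meets_req R Q r" and r: "\<forall>q\<in>Q. r q \<le> 3"
    and crit: "critical R Q r u v" and uv: "u \<notin> Q" "v \<notin> Q"
  shows "meets_req (contract R u v) Q r"
proof -
  have "min (r x) (r y) \<le> card S"
    if s: "separation (contract R u v) A S B" "x \<in> Q" "x \<in> A" "y \<in> Q" "y \<in> B" for A S B x y
  proof -
    define f where "f = id(v := u)"
    have sub: "f -` S \<subseteq> insert v S" by (auto simp: f_def split: if_splits)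
    have fin: "finite S" using s by (simp add: separation_def)
    then have fin': "finite (f -` S)" using sub by (meson finite_insert finite_subset)
    have sep: "separation R (f -` A) (f -` S) (f -` B)"
      using s(1) fin' unfolding separation_def contract_def f_def[symmetric] by blast
    have xy: "x \<in> f -` A" "y \<in> f -` B" using s uv by (auto simp: f_def)
    show ?thesis
    proof (cases "u \<in> S")
      case True
      then have "u \<in> f -` S" "v \<in> f -` S" by (auto simp: f_def)
      then have "min (r x) (r y) < card (f -` S)"
        by (rule critical_separation_larger[OF R r crit uv sep s(2) xy(1) s(4) xy(2)])
      also have "\<dots> \<le> Suc (card S)" using card_mono[OF _ sub] fin by (simp add: card_insert_if split: if_splits)
      finally show ?thesis by simp
    next
      case False
      \<comment> \<open>Even if \<open>v\<close> is in \<open>S\<close>, it drops out of the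
        preimage, since \<open>f\<close> sends it to \<open>u\<close>.\<close>
      then have "f -` S \<subseteq> S" by (auto simp: f_def split: if_splits)
      then have "card (f -` S) \<le> card S" using fin by (rule card_mono[rotated])
      then show ?thesis using meets_reqD[OF R(2) sep s(2) xy(1) s(4) xy(2)] by simp
    qed
  qed
  then show ?thesis unfolding meets_req_def by blast
qed

text \<open>The violating separation is pushed forward, which cannot enlarge \<open>S\<close>. As
  \<open>uv\<close> is not the deleted edge, \<open>u\<close> and \<open>v\<close> are never on
  opposite sides, so merging them creates no crossing.\<close>

lemma critical_contract:
  assumes R: "symp R" "R u v" and crit: "critical R Q r p q" and uv: "u \<notin> Q" "v \<notin> Q"
    and ne: "{p, q} \<noteq> {u, v}"
  defines "f \<equiv> id(v := u)"
  shows "critical (contract R u v) Q r (f p) (f q)"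
proof -
  obtain A S B x y where c: "separation (delete R p q) A S B" "x \<in> Q" "x \<in> A" "y \<in> Q" "y \<in> B"
    "card S < min (r x) (r y)" using crit unfolding critical_def by blast
  \<comment> \<open>If one of \<open>u\<close> and \<open>v\<close> lies in \<open>S\<close>, the
    merged vertex belongs to the separator. Taking \<open>B'\<close> as a complement also places the
    points outside the image of \<open>f\<close>.\<close>
  define A' where "A' = f ` A - f ` S"
  define B' where "B' = - (A' \<union> f ` S)"
  have fin: "finite S" using separationD(1)[OF c(1)] .
  have cR: "{a, b} = {p, q}" if "R a b" "a \<in> A" "b \<in> B" for a b
    using separationD(9)[OF c(1)] that unfolding delete_def by blast
  have cross: "\<not> (u \<in> A \<and> v \<in> B)" "\<not> (v \<in> A \<and> u \<in> B)"
    using cR[of u v] cR[of v u] R(2) sympD[OF R] ne by (auto simp: insert_commute)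
  have noedge: "\<not> delete (contract R u v) (f p) (f q) a b" if "a \<in> A'" "b \<in> B'" for a b
  proof
    assume "delete (contract R u v) (f p) (f q) a b"
    then obtain a0 b0 where ab: "R a0 b0" "f a0 = a" "f b0 = b" "{a, b} \<noteq> {f p, f q}"
      unfolding delete_def contract_def f_def by blast
    have "f a0 \<notin> f ` S" "f b0 \<notin> f ` S" "f b0 \<notin> f ` A"
      using that ab(2,3) unfolding A'_def B'_def by simp_all
    then have "a0 \<notin> S" "b0 \<notin> S" "b0 \<notin> A" by blast+
    then have b0: "b0 \<in> B" using separationD(7)[OF c(1)] by blast
    have "a \<in> f ` A" using that(1) unfolding A'_def by simp
    then obtain a1 where a1: "a1 \<in> A" "f a1 = a" by blast
    \<comment> \<open>The preimage \<open>a0\<close> used by the edge need not be the one in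
      \<open>A\<close>; if they differ, they are \<open>u\<close> and \<open>v\<close>, and
      \<open>cross\<close> keeps \<open>a0\<close> out of \<open>B\<close>.\<close>
    then have "a0 = a1 \<or> a0 = u \<and> a1 = v \<or> a0 = v \<and> a1 = u"
      using ab(2) by (auto simp: f_def split: if_splits)
    then have "a0 \<notin> B" using a1(1) cross separationD(3)[OF c(1)] by blast
    then have "a0 \<in> A" using \<open>a0 \<notin> S\<close> separationD(6)[OF c(1)] by blast
    then have "f ` {a0, b0} = f ` {p, q}" using cR[OF ab(1) _ b0] by simp
    then show False using ab by simp
  qed
  have "separation (delete (contract R u v) (f p) (f q)) A' (f ` S) B'"
  proof -
    have "A' \<inter> f ` S = {}" "B' \<inter> f ` S = {}" "A' \<inter> B' = {}" "A' \<union> f ` S \<union> B' = UNIV"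
      unfolding A'_def B'_def by blast+
    then show ?thesis using noedge fin by (simp add: separation_def)
  qed
  moreover have "x \<in> A'" "y \<in> B'"
  proof -
    have fz: "f z = x \<longleftrightarrow> z = x" "f z = y \<longleftrightarrow> z = y" for z using c uv by (auto simp: f_def)
    have "x \<notin> S" "y \<notin> S" "y \<notin> A" using separationD(2,4,5)[OF c(1)] c(3,5) by blast+
    then have "x \<notin> f ` S" "y \<notin> f ` S" "y \<notin> f ` A" using fz by (metis imageE)+
    moreover have "x \<in> f ` A" using c(3) fz(1) by (metis imageI)
    ultimately show "x \<in> A'" "y \<in> B'" unfolding A'_def B'_def by simp_all
  qed
  moreover have "card (f ` S) < min (r x) (r y)" using c(6) card_image_le[OF fin, of f] by linarith
  ultimately show ?thesis unfolding critical_def using c(2,4) by blast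
qed

text \<open>In the small separation for \<open>vw\<close> the common neighbour \<open>u\<close> must
  lie in \<open>S\<close>. Contracting \<open>uv\<close> then moves edges only to a vertex of
  \<open>S\<close>, so the same three sets would violate the requirement in the contraction.\<close>

lemma no_critical_triangle:
  assumes R: "symp R" "meets_req R Q r" and r: "\<forall>q\<in>Q. r q \<le> 3"
    and uvw: "R u v" "R u w" "u \<noteq> v" "u \<noteq> w" "u \<notin> Q" "v \<notin> Q"
    and crit: "critical R Q r u v" "critical R Q r v w"
  shows False
proof -
  obtain A S B x y where c: "separation (delete R v w) A S B" "x \<in> Q" "x \<in> A" "y \<in> Q" "y \<in> B"
    "card S < min (r x) (r y)" "v \<in> A" "w \<in> B" using critical_cut[OF R crit(2)] by blast
  have "R v u" using R(1) uvw(1) by (rule sympD)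
  then have "u \<notin> A" "u \<notin> B"
    using uvw separationD(9)[OF c(1), of u w] separationD(9)[OF c(1), of v u] c(7,8)
    by (auto simp: delete_def doubleton_eq_iff)
  then have u: "u \<in> S" by (rule separationD(8)[OF c(1)])
  then have AB: "u \<notin> A" "u \<notin> B" "v \<notin> B" "w \<notin> A" using separationD[OF c(1)] c(7,8) by blast+
  have "\<not> contract R u v a b" if "a \<in> A" "b \<in> B" for a b
  proof
    assume "contract R u v a b"
    then obtain a' b' where ab: "R a' b'" "(id(v := u)) a' = a" "(id(v := u)) b' = b"
      unfolding contract_def by blast
    then have "a' = a" "b' = b" "a \<noteq> v" "b \<noteq> v"
      using that AB uvw(3) by (auto split: if_splits)
    then have "delete R v w a b" using ab(1) by (auto simp: delete_def doubleton_eq_iff)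
    then show False using separationD(9)[OF c(1)] that by blast
  qed
  then have "separation (contract R u v) A S B" using c(1) unfolding separation_def by blast
  then have "min (r x) (r y) \<le> card S"
    using meets_reqD[OF meets_req_contract[OF R r crit(1) uvw(5,6)]] c by blast
  then show False using c(6) by simp
qed

text \<open>Induction on the length, for all relations at once: contracting the first edge removes
  \<open>v\<close> from the cycle and preserves every hypothesis, down to the triangle.\<close>

lemma no_critical_cycle:
  assumes "symp R" "meets_req R Q r" and r: "\<forall>q\<in>Q. r q \<le> 3"
    and "length c \<ge> 3" "distinct c" "set c \<inter> Q = {}"
    and "successively (\<lambda>a b. R a b \<and> critical R Q r a b) c"
    and "R (last c) (hd c) \<and> critical R Q r (last c) (hd c)"
  shows False
  using assms(1,2,4-)
proof (induction "length c" arbitrary: c R rule: less_induct)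
  case less
  obtain u v w ds where c: "c = u # v # w # ds"
    using less.prems(3) by (cases c; cases "tl c"; cases "tl (tl c)") auto
  have Q: "u \<notin> Q" "v \<notin> Q" using less.prems c by auto
  have uv: "R u v" "critical R Q r u v" "critical R Q r v w" using less.prems c by auto
  show False
  proof (cases "ds = []")
    case True
    then have "R u w" using less.prems(1,7) c by (auto dest: sympD)
    then show False
      using no_critical_triangle[OF less.prems(1,2) r uv(1) _ _ _ Q uv(2,3)] less.prems(4) c by auto
  next
    case False
    let ?R = "contract R u v" and ?f = "id(v := u)"
    have step: "?R (?f a) (?f b) \<and> critical ?R Q r (?f a) (?f b)"
      if "R a b \<and> critical R Q r a b" "{a, b} \<noteq> {u, v}" for a b
      using critical_contract[OF less.prems(1) uv(1) _ Q that(2)] that(1) unfolding contract_def by blast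
    have 1: "?R u w \<and> critical ?R Q r u w"
      using step[of v w] less.prems c by (auto simp: doubleton_eq_iff)
    have 2: "successively (\<lambda>a b. ?R a b \<and> critical ?R Q r a b) (w # ds)"
    proof (rule successively_mono)
      show "successively (\<lambda>a b. R a b \<and> critical R Q r a b) (w # ds)" using less.prems c by simp
      fix a b assume ab: "a \<in> set (w # ds)" "b \<in> set (w # ds)" "R a b \<and> critical R Q r a b"
      then have "a \<noteq> u" "a \<noteq> v" "b \<noteq> v" using less.prems(4) c by auto
      then show "?R a b \<and> critical ?R Q r a b"
        using step[OF ab(3)] by (simp add: doubleton_eq_iff)
    qed
    \<comment> \<open>The closing edge meets \<open>u\<close> but avoids \<open>v\<close>, so it is
      not the contracted edge and is fixed by the contraction map.\<close>
    have "last ds \<noteq> v" "last ds \<noteq> u" using False less.prems(4) c last_in_set[of ds] by auto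
    then have 3: "?R (last ds) u \<and> critical ?R Q r (last ds) u"
      using step[of "last ds" u] less.prems c False by (auto simp: doubleton_eq_iff)
    show False
    proof (rule less.hyps)
      show "length (u # w # ds) < length c" using c by simp
      show "symp ?R" using less.prems(1) by (rule symp_contract)
      show "meets_req ?R Q r" using meets_req_contract[OF less.prems(1,2) r uv(2) Q] .
      show "length (u # w # ds) \<ge> 3" using False by (cases ds) auto
      show "distinct (u # w # ds)" "set (u # w # ds) \<inter> Q = {}" using less.prems(4,5) c by auto
      show "successively (\<lambda>a b. ?R a b \<and> critical ?R Q r a b) (u # w # ds)" using 1 2 by simp
      show "?R (last (u # w # ds)) (hd (u # w # ds)) \<and>
          critical ?R Q r (last (u # w # ds)) (hd (u # w # ds))"
        using 3 False by simp
    qed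
  qed
qed

section \<open>Subdividing the edges between terminals\<close>

text \<open>Without subdivision, adjacent terminals would have no separating vertex set at all. The other edges
  are left alone, so that the edges of a cycle avoiding \<open>Q\<close> remain edges.\<close>

fun subdivision :: "'a set set \<Rightarrow> 'a set \<Rightarrow> 'a + 'a set \<Rightarrow> 'a + 'a set \<Rightarrow> bool" where
  "subdivision E Q (Inl a) (Inl b) \<longleftrightarrow> {a, b} \<in> E \<and> \<not> {a, b} \<subseteq> Q"
| "subdivision E Q (Inl a) (Inr f) \<longleftrightarrow> f \<in> E \<and> f \<subseteq> Q \<and> a \<in> f"
| "subdivision E Q (Inr f) (Inl a) \<longleftrightarrow> f \<in> E \<and> f \<subseteq> Q \<and> a \<in> f"
| "subdivision E Q (Inr f) (Inr g) \<longleftrightarrow> False"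

lemma symp_subdivision: "symp (subdivision E Q)"
proof (rule sympI)
  fix a b show "subdivision E Q a b \<Longrightarrow> subdivision E Q b a"
    by (cases a; cases b) (auto simp: insert_commute)
qed

section \<open>Paths of the graph and separations of its subdivision\<close>

lemma internal_path:
  assumes "is_path V E x y p" "x \<noteq> y"
  shows "internal p = set p - {x, y}"
proof -
  have "p = x # tl p" "tl p \<noteq> []" using assms by (cases p; cases "tl p"; auto simp: is_path_def)+
  then obtain m where "p = x # m @ [y]"
    using assms(1) by (metis append_butlast_last_id is_path_def last_ConsR)
  then show ?thesis using assms by (auto simp: is_path_def internal_def butlast_append)
qed

text \<open>Every path leaves \<open>A\<close> somewhere and there picks up an element of
  \<open>S\<close>: a vertex, or the subdividing vertex of an edge that jumps straight to
  \<open>B\<close>. Internal disjointness makes these elements distinct.\<close>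

lemma k_vertex_connected_separation:
  assumes k: "k_vertex_connected V E k x y" and xy: "x \<noteq> y"
    and sep: "separation (subdivision E Q) A S B" "Inl x \<in> A" "Inl y \<in> B"
  shows "k \<le> card S"
proof -
  obtain P where P: "finite P" "card P = k" "\<And>p. p \<in> P \<Longrightarrow> is_path V E x y p"
    "\<And>p q. p \<in> P \<Longrightarrow> q \<in> P \<Longrightarrow> p \<noteq> q \<Longrightarrow> internal p \<inter> internal q = {}"
    using k unfolding k_vertex_connected_def by blast
  have cov: "z \<in> A \<or> z \<in> S \<or> z \<in> B" for z using separationD(8)[OF sep(1)] by blast
  note disj = separationD(2,3)[OF sep(1)] and disj' = separationD(4)[OF sep(1)]
  have ex: "\<exists>i. Suc i < length p \<and> Inl (p ! i) \<in> A \<and>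
      (Inl (p ! Suc i) \<in> S \<or> Inl (p ! Suc i) \<in> B \<and> Inr {p ! i, p ! Suc i} \<in> S)" if p: "p \<in> P" for p
  proof -
    have pp: "p \<noteq> []" "hd p = x" "last p = y" "\<And>i. Suc i < length p \<Longrightarrow> {p ! i, p ! Suc i} \<in> E"
      using P(3)[OF p] by (auto simp: is_path_def)
    have "\<exists>i. Suc i < length p \<and> Inl (p ! i) \<in> A \<and> Inl (p ! Suc i) \<notin> A"
    proof (rule ccontr)
      assume neg: "\<not> ?thesis"
      have "i < length p \<Longrightarrow> Inl (p ! i) \<in> A" for i
        by (induction i) (use neg sep(2) pp in \<open>auto simp: hd_conv_nth\<close>)
      from this[of "length p - 1"] have "Inl (last p) \<in> A" using pp(1) by (simp add: last_conv_nth)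
      then show False using pp sep disj by auto
    qed
    then obtain i where i: "Suc i < length p" "Inl (p ! i) \<in> A" "Inl (p ! Suc i) \<notin> A" by blast
    let ?a = "p ! i" and ?b = "p ! Suc i"
    have "Inl ?b \<in> S \<or> Inl ?b \<in> B" using i cov by blast
    moreover have "Inr {?a, ?b} \<in> S" if b: "Inl ?b \<in> B"
    proof -
      have "\<not> subdivision E Q (Inl ?a) (Inl ?b)" using separationD(9)[OF sep(1) i(2) b] .
      then have e: "{?a, ?b} \<in> E" "{?a, ?b} \<subseteq> Q"
        using pp(4)[OF i(1)] unfolding subdivision.simps by blast+
      then have "subdivision E Q (Inl ?a) (Inr {?a, ?b})" "subdivision E Q (Inr {?a, ?b}) (Inl ?b)" by auto
      then have "Inr {?a, ?b} \<notin> A" "Inr {?a, ?b} \<notin> B"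
        using separationD(9)[OF sep(1)] i(2) b by blast+
      then show ?thesis using cov by blast
    qed
    ultimately show ?thesis using i by blast
  qed
  have "\<forall>p\<in>P. \<exists>i. Suc i < length p \<and> Inl (p ! i) \<in> A \<and>
      (Inl (p ! Suc i) \<in> S \<or> Inl (p ! Suc i) \<in> B \<and> Inr {p ! i, p ! Suc i} \<in> S)" using ex by blast
  then obtain i where i: "\<forall>p\<in>P. Suc (i p) < length p \<and> Inl (p ! i p) \<in> A \<and>
      (Inl (p ! Suc (i p)) \<in> S \<or> Inl (p ! Suc (i p)) \<in> B \<and> Inr {p ! i p, p ! Suc (i p)} \<in> S)"
    by (rule bchoice[THEN exE])
  define a b where "a p = p ! i p" and "b p = p ! Suc (i p)" for p
  have abi: "Suc (i p) < length p \<and> Inl (a p) \<in> A \<and> (Inl (b p) \<in> S \<or> Inl (b p) \<in> B \<and> Inr {a p, b p} \<in> S)" if "p \<in> P" for p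
    using i that by (simp add: a_def b_def)
  \<comment> \<open>The element of \<open>S\<close> charged to the path \<open>p\<close>.\<close>
  define s where "s p = (if Inl (b p) \<in> S then Inl (b p) else Inr {a p, b p})" for p
  have sS: "s ` P \<subseteq> S" using abi by (auto simp: s_def)
  have ab_in: "a p \<in> set p" "b p \<in> set p" if "p \<in> P" for p
    using abi[OF that] by (auto simp: a_def b_def)
  have meet: "p = q" if "p \<in> P" "q \<in> P" "z \<in> set p" "z \<in> set q" "z \<noteq> x" "z \<noteq> y" for p q z
    using P(4)[of p q] internal_path[OF P(3) xy] that by blast
  \<comment> \<open>For the edge \<open>xy\<close>, internal disjointness says nothing, as every
    path contains \<open>x\<close> and \<open>y\<close>. But a distinct path using this edge from
    \<open>x\<close> to \<open>y\<close> is just \<open>[x, y]\<close>.\<close>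
  have direct: "p = [x, y]" if p: "p \<in> P" and "a p = x" "b p = y" for p
  proof -
    have pp: "p \<noteq> []" "hd p = x" "last p = y" "distinct p" using P(3)[OF p] by (auto simp: is_path_def)
    have "p ! i p = p ! 0" "p ! Suc (i p) = p ! (length p - 1)"
      using that pp by (auto simp: a_def b_def hd_conv_nth last_conv_nth)
    then have "i p = 0" "Suc (i p) = length p - 1"
      using abi[OF p] pp(1,4) by (metis Suc_lessD length_greater_0_conv nth_eq_iff_index_eq,
        metis diff_less length_greater_0_conv less_numeral_extra(1) nth_eq_iff_index_eq)
    then have "length p = 2" by simp
    then show ?thesis using pp by (cases p; cases "tl p") auto
  qed
  have "inj_on s P"
  proof (rule inj_onI)
    fix p q assume pq: "p \<in> P" "q \<in> P" "s p = s q"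
    show "p = q"
    proof (cases "Inl (b p) \<in> S")
      case True
      then have b: "b p = b q" using pq(3) by (auto simp: s_def split: if_splits)
      have "b p \<noteq> x" "b p \<noteq> y" using True sep disj disj' by auto
      then show ?thesis using meet[OF pq(1,2), of "b p"] ab_in pq b by metis
    next
      case False
      then have Q: "Inl (b q) \<notin> S" "{a p, b p} = {a q, b q}" using pq(3) by (auto simp: s_def split: if_splits)
      have B: "Inl (b p) \<in> B" "Inl (b q) \<in> B" using abi pq False Q(1) by blast+
      \<comment> \<open>The sides fix the direction of the common edge: its tail is in
        \<open>A\<close>, its head in \<open>B\<close>.\<close>
      then have "a p \<noteq> b q" using abi[OF pq(1)] disj by metis
      then have e: "a p = a q" "b p = b q" using Q(2) by (auto simp: doubleton_eq_iff)
      have ne: "a p \<noteq> y" "b p \<noteq> x" using abi[OF pq(1)] B sep disj by auto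
      show ?thesis
      proof (cases "a p = x \<and> b p = y")
        case True
        then show ?thesis using direct pq e by metis
      next
        case False
        then show ?thesis using meet[OF pq(1,2)] ab_in pq e ne by metis
      qed
    qed
  qed
  then have "card P \<le> card S" using sS sep(1) by (intro card_inj_on_le) (auto simp: separation_def)
  then show ?thesis using P by simp
qed

text \<open>Failure of the path requirement yields a mixed cut, whose edge \<open>xy\<close>, if
  present, becomes the separating vertex \<open>Inr {x, y}\<close>. Since \<open>u\<close> is no
  terminal, \<open>uv\<close> is not subdivided, so deleting it in the graph matches deleting it in
  the subdivision.\<close>

lemma critical_subdivision:
  fixes E :: "'a set set"
  assumes G: "graph V E" and QV: "Q \<subseteq> V" and Qr: "\<not> Qr_vertex_connected V (E - {{u, v}}) Q r"
    and uv: "u \<notin> Q"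
  shows "critical (subdivision E Q) (Inl ` Q) (case_sum r g) (Inl u) (Inl v)"
proof -
  let ?E = "E - {{u, v}}"
  have G': "graph V ?E" using G by (auto simp: graph_def)
  obtain x y where xy: "x \<in> Q" "y \<in> Q" "x \<noteq> y" "\<not> k_vertex_connected V ?E (min (r x) (r y)) x y"
    using Qr QV unfolding Qr_vertex_connected_def by blast
  have xyV: "x \<in> V" "y \<in> V" using xy QV by blast+
  obtain A S where c: "finite S" "A \<inter> S = {}" "x \<in> A" "y \<notin> A \<union> S"
    "\<And>a b. a \<in> A \<Longrightarrow> {a, b} \<in> ?E \<Longrightarrow> b \<in> A \<union> S \<or> {a, b} = {x, y}"
    "card S + (if {x, y} \<in> ?E then 1 else 0) < min (r x) (r y)"
    by (rule menger_mixed[OF G' xyV xy(3,4)], rule that)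
  \<comment> \<open>A subdividing vertex joins side \<open>A\<close> as soon as its edge has an end
    there. Sets that are not edges are placed too, because a separation partitions the whole
    type.\<close>
  define A' where "A' = Inl ` A \<union> Inr ` {f. f \<noteq> {x, y} \<and> f \<inter> A \<noteq> {}}"
  define S' where "S' = Inl ` S \<union> (if {x, y} \<in> ?E then {Inr {x, y}} else {})"
  define B' where "B' = - (A' \<union> S')"
  have mem: "Inl a \<in> A' \<longleftrightarrow> a \<in> A" "Inl a \<in> S' \<longleftrightarrow> a \<in> S" "Inl a \<in> B' \<longleftrightarrow> a \<notin> A \<and> a \<notin> S"
    "Inr f \<in> A' \<longleftrightarrow> f \<noteq> {x, y} \<and> f \<inter> A \<noteq> {}" "Inr f \<in> S' \<longleftrightarrow> f = {x, y} \<and> f \<in> ?E"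
    "Inr f \<in> B' \<longleftrightarrow> \<not> (f \<noteq> {x, y} \<and> f \<inter> A \<noteq> {}) \<and> \<not> (f = {x, y} \<and> f \<in> ?E)" for a f
    unfolding B'_def A'_def S'_def by auto
  have noedge: "\<not> delete (subdivision E Q) (Inl u) (Inl v) p q" if p: "p \<in> A'" and q: "q \<in> B'" for p q
  proof
    assume "delete (subdivision E Q) (Inl u) (Inl v) p q"
    then have R: "subdivision E Q p q" "{p, q} \<noteq> {Inl u, Inl v}" by (auto simp: delete_def)
    show False
    proof (cases p; cases q)
      fix a b assume pq: "p = Inl a" "q = Inl b"
      have ab: "{a, b} \<in> E" "\<not> {a, b} \<subseteq> Q" using R(1) unfolding pq subdivision.simps by blast+
      have "{a, b} \<noteq> {u, v}" using R(2) unfolding pq by (auto simp: doubleton_eq_iff)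
      then have "{a, b} \<in> ?E" using ab(1) by simp
      \<comment> \<open>An unsubdivided edge has an end outside \<open>Q\<close>, so it is not the
        exceptional edge of the mixed cut.\<close>
      moreover have "{x, y} \<subseteq> Q" using xy by simp
      then have "{a, b} \<noteq> {x, y}" using ab(2) by metis
      ultimately show False using p q c(5)[of a b] unfolding pq mem by blast
    next
      fix a f assume pq: "p = Inl a" "q = Inr f"
      then have "f \<in> ?E" "a \<in> f" using R uv by auto
      then show False using p q unfolding pq mem by blast
    next
      fix f b assume pq: "p = Inr f" "q = Inl b"
      then have f: "f \<in> ?E" "b \<in> f" using R(1) uv by auto
      obtain a where a: "a \<in> f" "a \<in> A" using p unfolding pq mem by blast
      have b: "b \<notin> A" "b \<notin> S" using q unfolding pq mem by blast+
      obtain d e where "f = {d, e}" using G f unfolding graph_def by blast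
      then have "f = {a, b}" using a b f by auto
      then show False using c(5)[OF a(2), of b] f b p unfolding pq mem by blast
    next
      fix f g assume "p = Inr f" "q = Inr g"
      then show False using R by simp
    qed
  qed
  have "finite S'" using c(1) by (simp add: S'_def)
  moreover have "A' \<inter> S' = {}"
  proof -
    have "z \<notin> S'" if "z \<in> A'" for z using that c(2) by (cases z) (auto simp: mem)
    then show ?thesis by blast
  qed
  ultimately have "separation (delete (subdivision E Q) (Inl u) (Inl v)) A' S' B'"
    using noedge unfolding separation_def B'_def by blast
  moreover have "card S' = card S + (if {x, y} \<in> ?E then 1 else 0)"
  proof -
    have "card (Inl ` S :: ('a + 'a set) set) = card S" by (simp add: card_image)
    moreover have "Inr {x, y} \<notin> (Inl ` S :: ('a + 'a set) set)" by auto
    ultimately show ?thesis using c(1) by (simp add: S'_def)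
  qed
  then have "card S' < min (case_sum r g (Inl x)) (case_sum r g (Inl y))" using c(6) by simp
  moreover have "Inl x \<in> Inl ` Q \<inter> A'" "Inl y \<in> Inl ` Q \<inter> B'" using c(3,4) xy by (auto simp: mem)
  ultimately show ?thesis unfolding critical_def by blast
qed

theorem theorem9:
  fixes V :: "'a set" and E :: "'a set set" and Q :: "'a set" and r :: "'a \<Rightarrow> nat"
  assumes "graph V E"
    and "Q \<subseteq> V"
    and "\<forall>q\<in>Q. r q \<in> {2, 3}"
    and "minimal_Qr_vertex_connected V E Q r"
    and "is_cycle V E c"
  shows "set c \<inter> Q \<noteq> {}"
proof
  assume cQ: "set c \<inter> Q = {}"
  \<comment> \<open>Subdividing vertices are not terminals; their requirement is filled in with
    0.\<close>
  let ?R = "subdivision E Q" and ?Q = "Inl ` Q" and ?r = "case_sum r (\<lambda>_. 0)"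
  have Qr: "Qr_vertex_connected V E Q r" and min: "\<And>e. e \<in> E \<Longrightarrow> \<not> Qr_vertex_connected V (E - {e}) Q r"
    using assms(4) by (auto simp: minimal_Qr_vertex_connected_def)
  have cyc: "length c \<ge> 3" "distinct c" "successively (\<lambda>a b. {a, b} \<in> E) c" "{last c, hd c} \<in> E"
    using assms(5) by (auto simp: is_cycle_def successively_conv_nth)
  \<comment> \<open>A cycle vertex lies outside \<open>Q\<close>, so its edges survive the
    subdivision unchanged and edge-minimality makes them critical.\<close>
  have crit: "?R (Inl a) (Inl b) \<and> critical ?R ?Q ?r (Inl a) (Inl b)" if "a \<in> set c" "{a, b} \<in> E" for a b
    using critical_subdivision[OF assms(1,2) min[OF that(2)]] that cQ by auto
  show False
  proof (rule no_critical_cycle)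
    show "symp ?R" by (rule symp_subdivision)
    show "meets_req ?R ?Q ?r"
      unfolding meets_req_def
    proof (intro allI ballI impI)
      fix A S B p q assume *: "p \<in> ?Q \<inter> A" "q \<in> ?Q \<inter> B" "separation ?R A S B"
      then obtain x y where xy: "p = Inl x" "q = Inl y" "x \<in> Q" "y \<in> Q" by blast
      moreover have "p \<noteq> q" using * separationD(3)[OF *(3)] by blast
      ultimately have ne: "x \<noteq> y" by blast
      have "k_vertex_connected V E (min (r x) (r y)) x y"
        using xy Qr ne by (auto simp: Qr_vertex_connected_def)
      then show "min (?r p) (?r q) \<le> card S"
        using k_vertex_connected_separation[OF _ ne *(3)] * xy by auto
    qed
    show "\<forall>q\<in>?Q. ?r q \<le> 3" using assms(3) by fastforce
    show "length (map Inl c) \<ge> 3" "distinct (map Inl c :: ('a + 'a set) list)"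
      using cyc by (auto simp: distinct_map)
    show "set (map Inl c) \<inter> ?Q = {}" using cQ by auto
    show "successively (\<lambda>a b. ?R a b \<and> critical ?R ?Q ?r a b) (map Inl c)"
      unfolding successively_map by (rule successively_mono[OF cyc(3)]) (use crit in blast)
    have "c \<noteq> []" using cyc(1) by auto
    then show "?R (last (map Inl c)) (hd (map Inl c)) \<and> critical ?R ?Q ?r (last (map Inl c)) (hd (map Inl c))"
      using crit[of "last c" "hd c"] cyc(4) by (simp add: last_map hd_map del: subdivision.simps)
  qed
qed

end
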